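(* Let $M$ be an $n$-dimensional GAP-space ($d$-parallelizable manifold) with parallelizing $\pi$-vector fields $\lambda_{(i)}(x,y)$, $i=1,\dots,n$, having components $\lambda_{(i)}^{\alpha}$ and inverse matrix $\lambda_{(i)\alpha}$. Then $M$ is a generalized Lagrange space: the tensor field $$g_{\mu\nu}(x,y):=\lambda_{(i)\mu}\,\lambda_{(i)\nu}$$ (summed over $i$) is a generalized Lagrange metric on $M$, i.e. a metric in the pullback bundle $\pi^{-1}(TM)$, with inverse given by $$g^{\mu\nu}(x,y)=\lambda_{(i)}^{\mu}\,\lambda_{(i)}^{\nu}.$$
   Context: $M$ is a $C^\infty$ manifold of dimension $n$, $\pi:TM\to M$ its tangent bundle, $(x^\mu,y^\mu)$ the local coordinates on $TM$ induced by a chart $(x^\mu)$ of $M$, and $\pi^{-1}(TM)$ the pullback of the bundle $TM$ by $\pi$. All objects are smooth in $(x,y)$. Tensor fields are sections of tensor bundles built from $\pi^{-1}(TM)$; their components depend on $(x,y)$ and transform with the Jacobian matrices of the change of $x$-coordinates. The summation convention is used for repeated Greek indices and repeated Latin (mesh) indices $i,j$, all running over $1,\dots,n$. $M$ is called a GAP-space, or $d$-parallelizable, if $\pi^{-1}(TM)$ admits $n$ global, everywhere linearly independent sections ($\pi$-vector fields) $\lambda_{(i)}(x,y)$, $i=1,\dots,n$. With $\lambda_{(i)}=(\lambda_{(i)}^{\alpha})$, $(\lambda_{(i)\alpha})$ denotes the inverse matrix: $\lambda_{(i)}^{\alpha}\lambda_{(i)\beta}=\delta^\alpha_\beta$, $\lambda_{(i)}^{\alpha}\lambda_{(j)\alpha}=\delta_{ij}$.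 A generalized Lagrange metric on $M$ is a symmetric non-degenerate tensor field $g_{\mu\nu}(x,y)$ of type $(0,2)$; the pair $(M,g)$ is then called a generalized Lagrange space. *)

theory Defs
  imports "HOL-Analysis.Analysis"
begin

(* Meant for open S; in finite dimension this is the usual class C^k. *)
fun Ck_on :: "nat \<Rightarrow> 'a::real_normed_vector set \<Rightarrow> ('a \<Rightarrow> 'b::real_normed_vector) \<Rightarrow> bool" where
  "Ck_on 0 S f \<longleftrightarrow> continuous_on S f"
| "Ck_on (Suc k) S f \<longleftrightarrow>
     (\<forall>x\<in>S. f differentiable (at x)) \<and>
     (\<forall>v. Ck_on k S (\<lambda>x. frechet_derivative f (at x) v))"

definition smooth_on :: "'a::real_normed_vector set \<Rightarrow> ('a \<Rightarrow> 'b::real_normed_vector) \<Rightarrow> bool" where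
  "smooth_on S f \<longleftrightarrow> (\<forall>k. Ck_on k S f)"

(* A chart is a pair (U, \<phi>); values of \<phi> outside U are irrelevant. The dimension is
   n = CARD('n). *)
type_synonym ('a, 'n) chart = "'a set \<times> ('a \<Rightarrow> real^'n)"

definition is_chart :: "'a topology \<Rightarrow> ('a, 'n::finite) chart \<Rightarrow> bool" where
  "is_chart M c \<longleftrightarrow>
     openin M (fst c) \<and> open (snd c ` fst c) \<and>
     homeomorphic_map (subtopology M (fst c)) (subtopology euclidean (snd c ` fst c)) (snd c)"

definition transition :: "('a, 'n::finite) chart \<Rightarrow> ('a, 'n) chart \<Rightarrow> real^'n \<Rightarrow> real^'n" where
  "transition c d = snd d \<circ> inv_into (fst c) (snd c)"

(* The atlas A is not required to be maximal; any A, in particular a maximal one, is allowed. *)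
definition smooth_manifold :: "'a topology \<Rightarrow> ('a, 'n::finite) chart set \<Rightarrow> bool" where
  "smooth_manifold M A \<longleftrightarrow>
     Hausdorff_space M \<and> second_countable M \<and>
     (\<forall>c\<in>A. is_chart M c) \<and>
     (\<Union>c\<in>A. fst c) = topspace M \<and>
     (\<forall>c\<in>A. \<forall>d\<in>A. smooth_on (snd c ` (fst c \<inter> fst d)) (transition c d))"

definition charts_at :: "('a, 'n::finite) chart set \<Rightarrow> 'a \<Rightarrow> ('a, 'n) chart set" where
  "charts_at A p = {c \<in> A. p \<in> fst c}"

(* With x the coordinates of c and x' those of d, the entry in row \<alpha> and column \<mu> is
   the partial derivative of x'^\<alpha> with respect to x^\<mu> at p. *)
definition jacobian :: "('a, 'n::finite) chart \<Rightarrow> ('a, 'n) chart \<Rightarrow> 'a \<Rightarrow> real^'n^'n" where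
  "jacobian c d p = matrix (frechet_derivative (transition c d) (at (snd c p)))"

(* A tangent vector at p is the family of its component vectors with respect to all charts
   around p. The family is undefined at other charts, so that it is determined by the
   vector. *)
type_synonym ('a, 'n) tvec = "('a, 'n) chart \<Rightarrow> real^'n"

definition tangent_space :: "('a, 'n::finite) chart set \<Rightarrow> 'a \<Rightarrow> ('a, 'n) tvec set" where
  "tangent_space A p =
     {v \<in> extensional (charts_at A p).
        \<forall>c\<in>charts_at A p. \<forall>d\<in>charts_at A p. v d = jacobian c d p *v v c}"

(* The projection \<pi> of the tangent bundle is fst. *)
definition tangent_bundle ::
    "'a topology \<Rightarrow> ('a, 'n::finite) chart set \<Rightarrow> ('a \<times> ('a, 'n) tvec) set" where
  "tangent_bundle M A = (SIGMA p : topspace M. tangent_space A p)"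

definition tangent_over ::
    "('a, 'n::finite) chart set \<Rightarrow> ('a, 'n) chart \<Rightarrow> ('a \<times> ('a, 'n) tvec) set" where
  "tangent_over A c = (SIGMA p : fst c. tangent_space A p)"

(* The coordinates (x, y) on the tangent bundle induced by a chart c. *)
definition induced_chart ::
    "('a, 'n::finite) chart \<Rightarrow> 'a \<times> ('a, 'n) tvec \<Rightarrow> (real^'n) \<times> (real^'n)" where
  "induced_chart c u = (snd c (fst u), snd u c)"

(* Let f u c be the components at the point u of the tangent bundle, with respect to the
   chart c. In each chart they must be smooth functions of (x, y). *)
definition smooth_components ::
    "('a, 'n::finite) chart set \<Rightarrow>
     ('a \<times> ('a, 'n) tvec \<Rightarrow> ('a, 'n) chart \<Rightarrow> 'b::real_normed_vector) \<Rightarrow> bool" where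
  "smooth_components A f \<longleftrightarrow>
     (\<forall>c\<in>A. smooth_on ((snd c ` fst c) \<times> UNIV)
        (\<lambda>z. f (inv_into (tangent_over A c) (induced_chart c) z) c))"

(* The fibre over u of the pullback of the tangent bundle by \<pi> is the tangent space at \<pi> u. *)
definition pi_vector_field ::
    "'a topology \<Rightarrow> ('a, 'n::finite) chart set \<Rightarrow> ('a \<times> ('a, 'n) tvec \<Rightarrow> ('a, 'n) tvec) \<Rightarrow> bool" where
  "pi_vector_field M A X \<longleftrightarrow>
     (\<forall>u\<in>tangent_bundle M A. X u \<in> tangent_space A (fst u)) \<and> smooth_components A X"

type_synonym ('a, 'n) tensor2 = "('a, 'n) chart \<Rightarrow> real^'n^'n"

(* Tensors of type (0,2) at p: with J = jacobian c d p the transformation rule is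
   T_\<mu>\<nu> = J^\<alpha>_\<mu> J^\<beta>_\<nu> T'_\<alpha>\<beta>. *)
definition tensor02_space :: "('a, 'n::finite) chart set \<Rightarrow> 'a \<Rightarrow> ('a, 'n) tensor2 set" where
  "tensor02_space A p =
     {T \<in> extensional (charts_at A p).
        \<forall>c\<in>charts_at A p. \<forall>d\<in>charts_at A p. \<forall>\<mu> \<nu>.
          T c $ \<mu> $ \<nu> =
            (\<Sum>\<alpha>\<in>UNIV. \<Sum>\<beta>\<in>UNIV.
               jacobian c d p $ \<alpha> $ \<mu> * jacobian c d p $ \<beta> $ \<nu> * T d $ \<alpha> $ \<beta>)}"

definition pi_tensor_field02 ::
    "'a topology \<Rightarrow> ('a, 'n::finite) chart set \<Rightarrow> ('a \<times> ('a, 'n) tvec \<Rightarrow> ('a, 'n) tensor2) \<Rightarrow> bool" where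
  "pi_tensor_field02 M A T \<longleftrightarrow>
     (\<forall>u\<in>tangent_bundle M A. T u \<in> tensor02_space A (fst u)) \<and> smooth_components A T"

definition symmetric_form :: "real^'n^'n::finite \<Rightarrow> bool" where
  "symmetric_form B \<longleftrightarrow> (\<forall>\<mu> \<nu>. B $ \<mu> $ \<nu> = B $ \<nu> $ \<mu>)"

definition nondegenerate_form :: "real^'n^'n::finite \<Rightarrow> bool" where
  "nondegenerate_form B \<longleftrightarrow>
     (\<forall>v. (\<forall>w. (\<Sum>\<mu>\<in>UNIV. \<Sum>\<nu>\<in>UNIV. B $ \<mu> $ \<nu> * v $ \<mu> * w $ \<nu>) = 0) \<longrightarrow> v = 0)"

definition generalized_Lagrange_metric ::
    "'a topology \<Rightarrow> ('a, 'n::finite) chart set \<Rightarrow> ('a \<times> ('a, 'n) tvec \<Rightarrow> ('a, 'n) tensor2) \<Rightarrow> bool" where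
  "generalized_Lagrange_metric M A g \<longleftrightarrow>
     pi_tensor_field02 M A g \<and>
     (\<forall>u\<in>tangent_bundle M A. \<forall>c\<in>charts_at A (fst u).
        symmetric_form (g u c) \<and> nondegenerate_form (g u c))"

definition generalized_Lagrange_space ::
    "'a topology \<Rightarrow> ('a, 'n::finite) chart set \<Rightarrow> ('a \<times> ('a, 'n) tvec \<Rightarrow> ('a, 'n) tensor2) \<Rightarrow> bool" where
  "generalized_Lagrange_space M A g \<longleftrightarrow>
     smooth_manifold M A \<and> generalized_Lagrange_metric M A g"

(* The mesh index i also ranges over 'n, so there are exactly n sections. Linear
   independence is meant in the fibre, whose operations are componentwise in every chart. *)
definition GAP_space ::
    "'a topology \<Rightarrow> ('a, 'n::finite) chart set \<Rightarrow>
     ('n \<Rightarrow> 'a \<times> ('a, 'n) tvec \<Rightarrow> ('a, 'n) tvec) \<Rightarrow> bool" where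
  "GAP_space M A lam \<longleftrightarrow>
     smooth_manifold M A \<and>
     (\<forall>i. pi_vector_field M A (lam i)) \<and>
     (\<forall>u\<in>tangent_bundle M A. \<forall>a :: 'n \<Rightarrow> real.
        (\<forall>c\<in>charts_at A (fst u). (\<Sum>i\<in>UNIV. a i *\<^sub>R lam i u c) = 0) \<longrightarrow> (\<forall>i. a i = 0))"

(* The matrix with lam_(i)^\<alpha> in row i, column \<alpha>. *)
definition frame_matrix ::
    "('n::finite \<Rightarrow> 'a \<times> ('a, 'n) tvec \<Rightarrow> ('a, 'n) tvec) \<Rightarrow>
     'a \<times> ('a, 'n) tvec \<Rightarrow> ('a, 'n) chart \<Rightarrow> real^'n^'n" where
  "frame_matrix lam u c = (\<chi> i \<alpha>. lam i u c $ \<alpha>)"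

(* lam_(i)\<alpha>. Both duality relations say that the matrix with lam_(i)\<alpha> in row \<alpha>,
   column i is the inverse of the frame matrix, hence the order of the indices. *)
definition coframe ::
    "('n::finite \<Rightarrow> 'a \<times> ('a, 'n) tvec \<Rightarrow> ('a, 'n) tvec) \<Rightarrow>
     'n \<Rightarrow> 'a \<times> ('a, 'n) tvec \<Rightarrow> ('a, 'n) chart \<Rightarrow> real^'n" where
  "coframe lam i u c = (\<chi> \<alpha>. matrix_inv (frame_matrix lam u c) $ \<alpha> $ i)"

definition gap_metric ::
    "('a, 'n::finite) chart set \<Rightarrow> ('n \<Rightarrow> 'a \<times> ('a, 'n) tvec \<Rightarrow> ('a, 'n) tvec) \<Rightarrow>
     'a \<times> ('a, 'n) tvec \<Rightarrow> ('a, 'n) tensor2" where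
  "gap_metric A lam u =
     (\<lambda>c\<in>charts_at A (fst u).
        \<chi> \<mu> \<nu>. \<Sum>i\<in>UNIV. coframe lam i u c $ \<mu> * coframe lam i u c $ \<nu>)"

definition gap_metric_inverse ::
    "('a, 'n::finite) chart set \<Rightarrow> ('n \<Rightarrow> 'a \<times> ('a, 'n) tvec \<Rightarrow> ('a, 'n) tvec) \<Rightarrow>
     'a \<times> ('a, 'n) tvec \<Rightarrow> ('a, 'n) tensor2" where
  "gap_metric_inverse A lam u =
     (\<lambda>c\<in>charts_at A (fst u).
        \<chi> \<mu> \<nu>. \<Sum>i\<in>UNIV. lam i u c $ \<mu> * lam i u c $ \<nu>)"

end

theory Submission
  imports Defs
begin

text \<open>Write \<open>F\<close> for the matrix of the frame in a chart and \<open>W\<close> for its inverse. Then the metric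
  is \<open>W W\<^sup>T\<close> and its inverse is \<open>F\<^sup>T F\<close>. Under a change of chart with Jacobian \<open>J\<close> the frame becomes
  \<open>F J\<^sup>T\<close>, so independence over all charts is independence in any one of them, and \<open>W = J\<^sup>T W'\<close>
  is the tensor rule. Smoothness of \<open>W\<close> is Cramer's rule. To use it at every point of the chart
  domain one has to know that every pair \<open>(x, y)\<close> is the coordinate pair of a tangent vector,
  which is the cocycle property of the Jacobians.\<close>

section \<open>Calculus of the classes \<open>Ck_on\<close> on open sets, up to determinants\<close>

section \<open>Smooth maps\<close>

text \<open>Since \<open>S\<close> is open, equality on \<open>S\<close> is equality near each of
  its points, so the derivatives agree there too and the induction passes to directional
  derivatives.\<close>

lemma Ck_on_cong:
  assumes "open S" "Ck_on k S f" "\<And>x. x \<in> S \<Longrightarrow> f x = g x"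
  shows "Ck_on k S g"
  using assms(2,3)
proof (induction k arbitrary: f g)
  case 0
  then show ?case using continuous_on_cong[of S S f g] by simp
next
  case (Suc k)
  have "(g has_derivative frechet_derivative f (at x)) (at x)" if "x \<in> S" for x
    using Suc.prems that has_derivative_transform_within_open[OF _ \<open>open S\<close> that, of f _ UNIV g]
    by (auto simp: frechet_derivative_works)
  then have *: "g differentiable (at x) \<and> frechet_derivative g (at x) = frechet_derivative f (at x)"
    if "x \<in> S" for x
    using that frechet_derivative_at by (metis differentiableI)
  have "Ck_on k S (\<lambda>x. frechet_derivative g (at x) v)" for v
    by (rule Suc.IH[of "\<lambda>x. frechet_derivative f (at x) v"]) (use Suc.prems * in auto)
  with * show ?case by simp
qed

text \<open>Lets the derivative be given by an explicit formula on \<open>S\<close>, so that the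
  usual differentiation rules can drive the inductions over \<open>k\<close>.\<close>

lemma Ck_on_SucI:
  assumes "open S"
    and "\<And>x. x \<in> S \<Longrightarrow> (f has_derivative f' x) (at x)"
    and "\<And>v. Ck_on k S (\<lambda>x. f' x v)"
  shows "Ck_on (Suc k) S f"
proof -
  have "frechet_derivative f (at x) = f' x" if "x \<in> S" for x
    using assms(2)[OF that] frechet_derivative_at by metis
  then have "Ck_on k S (\<lambda>x. frechet_derivative f (at x) v)" for v
    by (intro Ck_on_cong[OF \<open>open S\<close> assms(3)[of v]]) simp
  with assms(2) show ?thesis by (auto simp: differentiable_def)
qed

lemma Ck_on_has_derivative:
  assumes "Ck_on (Suc k) S f" "x \<in> S"
  shows "(f has_derivative frechet_derivative f (at x)) (at x)"
  using assms by (simp add: frechet_derivative_works)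

lemma Ck_on_SucD: "Ck_on (Suc k) S f \<Longrightarrow> Ck_on k S f"
proof (induction k arbitrary: f)
  case 0
  then show ?case
    by (auto intro!: continuous_at_imp_continuous_on differentiable_imp_continuous_within)
next
  case (Suc k)
  then show ?case by (metis Ck_on.simps(2))
qed

lemma Ck_on_const:
  assumes "open S"
  shows "Ck_on k S (\<lambda>x. c)"
proof (induction k arbitrary: c)
  case (Suc k)
  show ?case
    by (rule Ck_on_SucI[where f' = "\<lambda>_ _. 0"]) (use assms Suc in auto)
qed simp

lemma Ck_on_add:
  assumes "open S" "Ck_on k S f" "Ck_on k S g"
  shows "Ck_on k S (\<lambda>x. f x + g x)"
  using assms(2,3)
proof (induction k arbitrary: f g)
  case 0
  then show ?case by (simp add: continuous_on_add)
next
  case (Suc k)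
  show ?case
    by (rule Ck_on_SucI[OF assms(1) has_derivative_add[OF Ck_on_has_derivative Ck_on_has_derivative]])
       (use Suc in auto)
qed

lemma Ck_on_sum:
  assumes "open S" "\<And>i. i \<in> I \<Longrightarrow> Ck_on k S (f i)"
  shows "Ck_on k S (\<lambda>x. \<Sum>i\<in>I. f i x)"
  using assms(2)
  by (induction I rule: infinite_finite_induct) (auto intro: Ck_on_const Ck_on_add assms(1))

lemma Ck_on_bounded_linear:
  assumes "open S" "bounded_linear h" "Ck_on k S f"
  shows "Ck_on k S (\<lambda>x. h (f x))"
  using assms(3)
proof (induction k arbitrary: f)
  case 0
  then show ?case using assms(2) by (simp add: bounded_linear.continuous_on)
next
  case (Suc k)
  show ?case
    by (rule Ck_on_SucI[OF assms(1) bounded_linear.has_derivative[OF assms(2) Ck_on_has_derivative]])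
       (use Suc in auto)
qed

lemma Ck_on_mult:
  fixes f g :: "'a::real_normed_vector \<Rightarrow> real"
  assumes "open S" "Ck_on k S f" "Ck_on k S g"
  shows "Ck_on k S (\<lambda>x. f x * g x)"
  using assms(2,3)
proof (induction k arbitrary: f g)
  case 0
  then show ?case by (simp add: continuous_on_mult)
next
  case (Suc k)
  show ?case
  proof (rule Ck_on_SucI[OF assms(1) has_derivative_mult[OF Ck_on_has_derivative Ck_on_has_derivative]])
    show "Ck_on k S (\<lambda>x. f x * frechet_derivative g (at x) v + frechet_derivative f (at x) v * g x)" for v
      \<comment> \<open>The product rule keeps one factor undifferentiated;
        \<open>Ck_on_SucD\<close> lowers its order to that of the derivative.\<close>
      by (intro Ck_on_add[OF assms(1)] Suc.IH) (use Suc.prems Ck_on_SucD in auto)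
  qed (use Suc.prems in auto)
qed

lemma Ck_on_prod:
  fixes f :: "'i \<Rightarrow> 'a::real_normed_vector \<Rightarrow> real"
  assumes "open S" "\<And>i. i \<in> I \<Longrightarrow> Ck_on k S (f i)"
  shows "Ck_on k S (\<lambda>x. \<Prod>i\<in>I. f i x)"
  using assms(2)
  by (induction I rule: infinite_finite_induct) (auto intro: Ck_on_const Ck_on_mult assms(1))

text \<open>The derivative of \<open>inverse (f x)\<close> is built from
  \<open>inverse (f x)\<close> itself and the derivative of \<open>f\<close>, so the induction over
  \<open>k\<close> runs with \<open>f\<close> fixed.\<close>

lemma Ck_on_inverse:
  fixes f :: "'a::real_normed_vector \<Rightarrow> real"
  assumes "open S" "Ck_on k S f" "\<And>x. x \<in> S \<Longrightarrow> f x \<noteq> 0"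
  shows "Ck_on k S (\<lambda>x. inverse (f x))"
  using assms(2)
proof (induction k)
  case 0
  then show ?case using assms(3) by (simp add: continuous_on_inverse)
next
  case (Suc k)
  have inv: "Ck_on k S (\<lambda>x. inverse (f x))"
    using Suc Ck_on_SucD by blast
  show ?case
  proof (rule Ck_on_SucI[OF assms(1) Deriv.has_derivative_inverse[OF _ Ck_on_has_derivative]])
    have "Ck_on k S (\<lambda>x. - (inverse (f x) * (frechet_derivative f (at x) v * inverse (f x))))" for v
      by (intro Ck_on_bounded_linear[OF assms(1) bounded_linear_minus[OF bounded_linear_ident]]
          Ck_on_mult[OF assms(1)] inv) (use Suc.prems in simp)
    then show "Ck_on k S (\<lambda>x. - (inverse (f x) * frechet_derivative f (at x) v * inverse (f x)))" for v
      by (simp add: mult.assoc)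
  qed (use Suc.prems assms(3) in auto)
qed

lemma Ck_on_vec_nth:
  fixes f :: "'a::real_normed_vector \<Rightarrow> 'b::real_normed_vector^'n::finite"
  shows "open S \<Longrightarrow> Ck_on k S f \<Longrightarrow> Ck_on k S (\<lambda>x. f x $ i)"
  by (rule Ck_on_bounded_linear[OF _ bounded_linear_vec_nth])

text \<open>A vector is the sum of its components placed on the axes, and \<open>axis i\<close> is
  linear, hence bounded on a Euclidean space. Entries that are vectors are allowed so that two
  applications give matrices.\<close>

lemma Ck_on_vec_lambda:
  fixes f :: "'n::finite \<Rightarrow> 'a::real_normed_vector \<Rightarrow> 'b::euclidean_space"
  assumes "open S" "\<And>i. Ck_on k S (f i)"
  shows "Ck_on k S (\<lambda>x. \<chi> i. f i x)"
proof -
  have "bounded_linear (axis i :: 'b \<Rightarrow> 'b^'n)" for i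
    by (intro linear_conv_bounded_linear[THEN iffD1] linearI) (auto simp: axis_def vec_eq_iff)
  then have "Ck_on k S (\<lambda>x. \<Sum>i\<in>UNIV. axis i (f i x))"
    by (auto intro!: Ck_on_sum[OF assms(1)] Ck_on_bounded_linear[OF assms(1) _ assms(2)])
  moreover have "(\<Sum>i\<in>UNIV. axis i (f i x)) = (\<chi> i. f i x)" for x
    by (simp add: vec_eq_iff axis_def if_distrib cong: if_cong)
  ultimately show ?thesis by simp
qed

lemma Ck_on_det:
  fixes F :: "'a::real_normed_vector \<Rightarrow> real^'n^'n::finite"
  assumes "open S" "\<And>i j. Ck_on k S (\<lambda>x. F x $ i $ j)"
  shows "Ck_on k S (\<lambda>x. det (F x))"
  unfolding det_def
  by (intro Ck_on_sum Ck_on_mult Ck_on_prod Ck_on_const assms)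

section \<open>Smooth dependence of the inverse matrix, and non-degeneracy\<close>

section \<open>Matrices\<close>

lemma
  fixes F :: "real^'n^'n::finite"
  assumes "invertible F"
  shows matrix_inv_right: "F ** matrix_inv F = mat 1"
    and matrix_inv_left: "matrix_inv F ** F = mat 1"
  using someI_ex[OF assms[unfolded invertible_def]] by (auto simp: matrix_inv_def)

text \<open>Cramer's rule for \<open>F *v x = axis i 1\<close>, whose solution is column
  \<open>i\<close> of the inverse. The quotient is written as a product with
  \<open>inverse (det F)\<close> to fit \<open>Ck_on_mult\<close> and
  \<open>Ck_on_inverse\<close>.\<close>

lemma matrix_inv_entry:
  fixes F :: "real^'n^'n::finite"
  assumes "invertible F"
  shows "matrix_inv F $ a $ i =
    det (\<chi> r s. if s = a then axis i 1 $ r else F $ r $ s) * inverse (det F)"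
proof -
  have "F *v (matrix_inv F *v axis i 1) = axis i 1"
    by (simp add: matrix_vector_mul_assoc matrix_inv_right[OF assms])
  then have "matrix_inv F *v axis i 1 =
      (\<chi> k. det (\<chi> r s. if s = k then axis i 1 $ r else F $ r $ s) / det F)"
    using cramer[of F "matrix_inv F *v axis i 1" "axis i 1"] assms by (simp add: invertible_det_nz)
  then show ?thesis
    by (simp add: matrix_vector_mul_component matrix_vector_mult_basis column_def vec_eq_iff divide_inverse)
qed

lemma Ck_on_matrix_inv:
  fixes F :: "'a::real_normed_vector \<Rightarrow> real^'n^'n::finite"
  assumes "open S" "\<And>i j. Ck_on k S (\<lambda>x. F x $ i $ j)" "\<And>x. x \<in> S \<Longrightarrow> invertible (F x)"
  shows "Ck_on k S (\<lambda>x. matrix_inv (F x) $ a $ i)"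
proof (rule Ck_on_cong[OF assms(1)])
  show "Ck_on k S (\<lambda>x. det (\<chi> r s. if s = a then axis i 1 $ r else F x $ r $ s) * inverse (det (F x)))"
  proof (intro Ck_on_mult Ck_on_inverse Ck_on_det assms)
    show "Ck_on k S (\<lambda>x. (\<chi> r s. if s = a then axis i 1 $ r else F x $ r $ s) $ r $ s)" for r s
      \<comment> \<open>The replaced column is constant in \<open>x\<close>; the others are columns
        of \<open>F x\<close>.\<close>
      using assms by (cases "s = a") (auto intro: Ck_on_const)
  qed (use assms(3) in \<open>auto simp: invertible_det_nz\<close>)
qed (simp add: matrix_inv_entry assms(3))

lemma matrix_inv_unique:
  fixes F :: "real^'n^'n::finite"
  assumes "F ** B = mat 1"
  shows "matrix_inv F = B"
  by (metis assms invertible_right_inverse matrix_inv_left matrix_mul_assoc matrix_mul_lid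
      matrix_mul_rid)

text \<open>Testing against the basis vectors turns the hypothesis on \<open>v\<close> into
  \<open>v v* B = 0\<close>, and multiplying by the inverse of \<open>B\<close> on the right leaves
  \<open>v = 0\<close>.\<close>

lemma nondegenerate_form_if_invertible:
  fixes B :: "real^'n^'n::finite"
  assumes "invertible B"
  shows "nondegenerate_form B"
  unfolding nondegenerate_form_def
proof (intro allI impI)
  fix v :: "real^'n"
  assume "\<forall>w. (\<Sum>\<mu>\<in>UNIV. \<Sum>\<nu>\<in>UNIV. B $ \<mu> $ \<nu> * v $ \<mu> * w $ \<nu>) = 0"
  then have "(\<Sum>\<mu>\<in>UNIV. \<Sum>\<nu>\<in>UNIV. B $ \<mu> $ \<nu> * v $ \<mu> * axis j 1 $ \<nu>) = 0" for j
    by blast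
  then have "v v* B = 0"
    by (simp add: vec_eq_iff vector_matrix_mult_def axis_def if_distrib mult.commute cong: if_cong)
  then have "(v v* B) v* matrix_inv B = 0"
    by simp
  then show "v = 0"
    by (simp add: vector_matrix_mul_assoc matrix_inv_right[OF assms])
qed

section \<open>Chain rule for transition maps, and surjectivity of the induced coordinates\<close>

section \<open>Jacobians and tangent vectors\<close>

lemma chart_inv:
  assumes "is_chart M c" "p \<in> fst c"
  shows "inv_into (fst c) (snd c) (snd c p) = p"
proof -
  have "fst c \<subseteq> topspace M" using assms openin_subset by (auto simp: is_chart_def)
  then have "inj_on (snd c) (fst c)"
    using assms by (auto simp: is_chart_def homeomorphic_eq_everything_map topspace_subtopology inf_absorb2)
  then show ?thesis using assms by simp
qed

text \<open>A chart is an open map onto its image, and that image is open in the model space. This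
  supplies the neighbourhoods on which transition maps are compared.\<close>

lemma open_chart_image:
  assumes "is_chart M c" "openin M U"
  shows "open (snd c ` (fst c \<inter> U))"
proof -
  have "openin (subtopology M (fst c)) (fst c \<inter> U)"
    using assms by (metis inf.commute openin_subtopology)
  then have "openin (subtopology euclidean (snd c ` fst c)) (snd c ` (fst c \<inter> U))"
    using assms by (auto simp: is_chart_def homeomorphic_eq_everything_map open_map_def)
  then show ?thesis
    using assms by (auto simp: is_chart_def openin_open_eq)
qed

lemma transition_chart:
  assumes "is_chart M c" "p \<in> fst c"
  shows "transition c d (snd c p) = snd d p"
  using chart_inv[OF assms] by (simp add: transition_def)

lemma charts_at_is_chart:
  assumes "smooth_manifold M A" "c \<in> charts_at A p"
  shows "is_chart M c" "p \<in> fst c" "openin M (fst c)"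
  using assms by (auto simp: smooth_manifold_def charts_at_def is_chart_def)

lemma transition_has_derivative:
  assumes "smooth_manifold M A" "c \<in> charts_at A p" "d \<in> charts_at A p"
  shows "(transition c d has_derivative (\<lambda>v. jacobian c d p *v v)) (at (snd c p))"
proof -
  have "Ck_on (Suc 0) (snd c ` (fst c \<inter> fst d)) (transition c d)"
    using assms unfolding smooth_manifold_def smooth_on_def charts_at_def by blast
  then have *: "(transition c d has_derivative frechet_derivative (transition c d) (at (snd c p))) (at (snd c p))"
    by (rule Ck_on_has_derivative) (use assms in \<open>auto simp: charts_at_def\<close>)
  then have "jacobian c d p *v v = frechet_derivative (transition c d) (at (snd c p)) v" for v
    unfolding jacobian_def by (simp add: matrix_works has_derivative_linear)
  with * show ?thesis by simp
qed

lemma has_derivative_matrix_unique: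
  fixes P Q :: "real^'n^'m::finite"
  assumes "(f has_derivative (\<lambda>v. P *v v)) (at x)" "(f has_derivative (\<lambda>v. Q *v v)) (at x)"
  shows "P = Q"
  using has_derivative_unique[OF assms] by (metis matrix_eq)

text \<open>The chain rule: on the image of the triple overlap, an open neighbourhood of
  \<open>snd c p\<close>, the composite of two transition maps is the third, and derivatives are
  unique.\<close>

lemma jacobian_cocycle:
  assumes "smooth_manifold M A" "c \<in> charts_at A p" "d \<in> charts_at A p" "e \<in> charts_at A p"
  shows "jacobian d e p ** jacobian c d p = jacobian c e p"
proof -
  note ch = charts_at_is_chart[OF assms(1)]
  let ?S = "snd c ` (fst c \<inter> (fst d \<inter> fst e))"
  \<comment> \<open>The base point \<open>snd d p\<close> is rewritten as
    \<open>transition c d (snd c p)\<close>, the form the chain rule asks for.\<close>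
  have "(transition d e has_derivative (\<lambda>v. jacobian d e p *v v)) (at (transition c d (snd c p)))"
    using transition_has_derivative[OF assms(1,3,4)] transition_chart ch assms by metis
  from has_derivative_compose[OF transition_has_derivative[OF assms(1-3)] this]
  have "((\<lambda>x. transition d e (transition c d x)) has_derivative
      (\<lambda>v. (jacobian d e p ** jacobian c d p) *v v)) (at (snd c p))"
    by (simp add: matrix_vector_mul_assoc)
  moreover have "open ?S"
    using ch assms by (intro open_chart_image[of M] openin_Int) auto
  moreover have "snd c p \<in> ?S"
    using ch(2) assms by blast
  moreover have "transition d e (transition c d x) = transition c e x" if "x \<in> ?S" for x
    using that transition_chart ch(1) assms by (smt (verit) IntD1 IntD2 imageE)
  ultimately have "(transition c e has_derivative
      (\<lambda>v. (jacobian d e p ** jacobian c d p) *v v)) (at (snd c p))"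
    by (rule has_derivative_transform_within_open)
  then show ?thesis
    using has_derivative_matrix_unique transition_has_derivative[OF assms(1,2,4)] by blast
qed

text \<open>The cocycle rule with all charts equal only makes this matrix idempotent; that it is the
  identity comes from \<open>transition c c\<close> being the identity map near
  \<open>snd c p\<close>.\<close>

lemma jacobian_self:
  assumes "smooth_manifold M A" "c \<in> charts_at A p"
  shows "jacobian c c p = mat 1"
proof -
  note ch = charts_at_is_chart[OF assms]
  have "((\<lambda>x. x) has_derivative (\<lambda>v. mat 1 *v v)) (at (snd c p))"
    by simp
  moreover have "open (snd c ` fst c)" "snd c p \<in> snd c ` fst c"
    using ch by (auto simp: is_chart_def)
  moreover have "x = transition c c x" if "x \<in> snd c ` fst c" for x
    using that by (auto simp: transition_chart[OF ch(1)])
  ultimately have "(transition c c has_derivative (\<lambda>v. mat 1 *v v)) (at (snd c p))"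
    by (rule has_derivative_transform_within_open)
  then show ?thesis
    using has_derivative_matrix_unique transition_has_derivative[OF assms assms(2)] by blast
qed

text \<open>Components prescribed in one chart are carried to all others by the Jacobians.
  \<open>jacobian_cocycle\<close> makes the family consistent, and \<open>jacobian_self\<close>
  returns the prescribed value at \<open>c\<close>.\<close>

lemma tangent_vector_exists:
  assumes "smooth_manifold M A" "c \<in> charts_at A p"
  obtains v where "v \<in> tangent_space A p" "v c = y"
proof
  let ?v = "\<lambda>d\<in>charts_at A p. jacobian c d p *v y"
  show "?v \<in> tangent_space A p"
    using jacobian_cocycle[OF assms] by (auto simp: tangent_space_def matrix_vector_mul_assoc)
  show "?v c = y"
    using assms jacobian_self[OF assms] by simp
qed

text \<open>\<open>smooth_components\<close> evaluates at points chosen by \<open>inv_into\<close>.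
  These lie over the chart because \<open>induced_chart c\<close> reaches every \<open>z\<close> in
  the coordinate domain.\<close>

lemma inv_induced_chart:
  assumes "smooth_manifold M A" "c \<in> A" "z \<in> (snd c ` fst c) \<times> UNIV"
  defines "u \<equiv> inv_into (tangent_over A c) (induced_chart c) z"
  shows "u \<in> tangent_bundle M A" "c \<in> charts_at A (fst u)"
proof -
  obtain p where p: "p \<in> fst c" "fst z = snd c p"
    using assms(3) by auto
  then have "c \<in> charts_at A p"
    using assms(2) by (simp add: charts_at_def)
  then obtain v where "v \<in> tangent_space A p" "v c = snd z"
    by (rule tangent_vector_exists[OF assms(1)])
  then have "z \<in> induced_chart c ` tangent_over A c"
    using p by (intro image_eqI[of _ _ "(p, v)"]) (auto simp: induced_chart_def tangent_over_def prod_eq_iff)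
  then have "u \<in> tangent_over A c"
    unfolding u_def by (rule inv_into_into)
  moreover have "fst c \<subseteq> topspace M"
    using assms(1,2) by (auto simp: smooth_manifold_def)
  ultimately show "u \<in> tangent_bundle M A" "c \<in> charts_at A (fst u)"
    using assms(2) by (auto simp: tangent_over_def tangent_bundle_def charts_at_def)
qed

section \<open>Change of chart, inverse and smoothness for frame, coframe and metric\<close>

section \<open>The metric of a frame\<close>

lemma GAP_space_transform:
  assumes "GAP_space M A lam" "u \<in> tangent_bundle M A"
    "c \<in> charts_at A (fst u)" "d \<in> charts_at A (fst u)"
  shows "lam i u d = jacobian c d (fst u) *v lam i u c"
proof -
  have "lam i u \<in> tangent_space A (fst u)"
    using assms(1,2) by (simp add: GAP_space_def pi_vector_field_def)
  with assms(3,4) show ?thesis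
    unfolding tangent_space_def by blast
qed

lemma frame_matrix_transform:
  assumes "GAP_space M A lam" "u \<in> tangent_bundle M A"
    "c \<in> charts_at A (fst u)" "d \<in> charts_at A (fst u)"
  shows "frame_matrix lam u d = frame_matrix lam u c ** transpose (jacobian c d (fst u))"
  by (simp add: vec_eq_iff frame_matrix_def GAP_space_transform[OF assms] matrix_matrix_mult_def
      matrix_vector_mult_def transpose_def mult.commute)

lemma frame_matrix_invertible:
  assumes "GAP_space M A lam" "u \<in> tangent_bundle M A" "c \<in> charts_at A (fst u)"
  shows "invertible (frame_matrix lam u c)"
proof -
  have "a = 0" if "a v* frame_matrix lam u c = 0" for a
  proof -
    have "(\<Sum>i\<in>UNIV. a $ i *\<^sub>R lam i u c) = a v* frame_matrix lam u c"
      by (simp add: vec_eq_iff vector_matrix_mult_def frame_matrix_def mult.commute)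
    then have c0: "(\<Sum>i\<in>UNIV. a $ i *\<^sub>R lam i u c) = 0"
      using that by simp
    \<comment> \<open>\<open>GAP_space\<close> asks for the linear relation in every chart;
      linearity of the Jacobian carries it over from \<open>c\<close>.\<close>
    have "(\<Sum>i\<in>UNIV. a $ i *\<^sub>R lam i u d) = 0" if "d \<in> charts_at A (fst u)" for d
    proof -
      have "(\<Sum>i\<in>UNIV. a $ i *\<^sub>R lam i u d) = jacobian c d (fst u) *v (\<Sum>i\<in>UNIV. a $ i *\<^sub>R lam i u c)"
        using GAP_space_transform[OF assms that]
        by (simp add: linear_sum[OF matrix_vector_mul_linear] matrix_vector_mult_scaleR)
      with c0 show ?thesis by simp
    qed
    then have "\<forall>i. a $ i = 0"
      using assms unfolding GAP_space_def by blast
    then show "a = 0" by (simp add: vec_eq_iff)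
  qed
  \<comment> \<open>A trivial kernel of the transpose yields a left inverse, hence invertibility
    since the matrix is square.\<close>
  then have "\<exists>B. B ** transpose (frame_matrix lam u c) = mat 1"
    by (simp add: matrix_left_invertible_ker)
  then show ?thesis
    using invertible_left_inverse transpose_invertible by fastforce
qed

text \<open>The covector rule: the frame matrix in \<open>d\<close> is that in \<open>c\<close>
  times the transposed Jacobian, so moving this factor onto the inverse in \<open>d\<close> gives a
  right inverse in \<open>c\<close>.\<close>

lemma coframe_transform:
  assumes "GAP_space M A lam" "u \<in> tangent_bundle M A"
    "c \<in> charts_at A (fst u)" "d \<in> charts_at A (fst u)"
  shows "coframe lam i u c $ \<mu> = (\<Sum>\<alpha>\<in>UNIV. jacobian c d (fst u) $ \<alpha> $ \<mu> * coframe lam i u d $ \<alpha>)"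
proof -
  have "frame_matrix lam u c ** (transpose (jacobian c d (fst u)) ** matrix_inv (frame_matrix lam u d))
      = frame_matrix lam u d ** matrix_inv (frame_matrix lam u d)"
    by (simp add: frame_matrix_transform[OF assms] matrix_mul_assoc)
  also have "\<dots> = mat 1"
    by (rule matrix_inv_right[OF frame_matrix_invertible[OF assms(1,2,4)]])
  finally have "matrix_inv (frame_matrix lam u c) =
      transpose (jacobian c d (fst u)) ** matrix_inv (frame_matrix lam u d)"
    by (rule matrix_inv_unique)
  then show ?thesis
    by (simp add: coframe_def matrix_matrix_mult_def transpose_def)
qed

lemma gap_metric_eq:
  assumes "c \<in> charts_at A (fst u)"
  shows "gap_metric A lam u c =
    matrix_inv (frame_matrix lam u c) ** transpose (matrix_inv (frame_matrix lam u c))"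
  using assms by (simp add: gap_metric_def coframe_def matrix_matrix_mult_def transpose_def vec_eq_iff)

lemma gap_metric_inverse_eq:
  assumes "c \<in> charts_at A (fst u)"
  shows "gap_metric_inverse A lam u c = transpose (frame_matrix lam u c) ** frame_matrix lam u c"
  using assms
  by (simp add: gap_metric_inverse_def frame_matrix_def matrix_matrix_mult_def transpose_def vec_eq_iff)

lemma gap_metric_right_inverse:
  assumes "GAP_space M A lam" "u \<in> tangent_bundle M A" "c \<in> charts_at A (fst u)"
  shows "gap_metric A lam u c ** gap_metric_inverse A lam u c = mat 1"
proof -
  let ?F = "frame_matrix lam u c"
  note inv = frame_matrix_invertible[OF assms]
  \<comment> \<open>The two middle factors, transposes of the inverse and of the frame matrix, merge
    into the transpose of \<open>?F ** matrix_inv ?F\<close>, which is the identity.\<close>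
  have "gap_metric A lam u c ** gap_metric_inverse A lam u c =
      matrix_inv ?F ** transpose (?F ** matrix_inv ?F) ** ?F"
    by (simp add: gap_metric_eq gap_metric_inverse_eq assms matrix_transpose_mul matrix_mul_assoc)
  also have "\<dots> = mat 1"
    by (simp add: matrix_inv_right[OF inv] matrix_inv_left[OF inv] transpose_mat)
  finally show ?thesis .
qed

lemma gap_metric_tensor:
  assumes "GAP_space M A lam" "u \<in> tangent_bundle M A"
  shows "gap_metric A lam u \<in> tensor02_space A (fst u)"
proof -
  have "gap_metric A lam u c $ \<mu> $ \<nu> =
      (\<Sum>\<alpha>\<in>UNIV. \<Sum>\<beta>\<in>UNIV. jacobian c d (fst u) $ \<alpha> $ \<mu> * jacobian c d (fst u) $ \<beta> $ \<nu> *
        gap_metric A lam u d $ \<alpha> $ \<beta>)"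
    if "c \<in> charts_at A (fst u)" "d \<in> charts_at A (fst u)" for c d \<mu> \<nu>
  proof -
    let ?J = "\<lambda>\<alpha> \<mu>. jacobian c d (fst u) $ \<alpha> $ \<mu>" and ?L = "\<lambda>i \<alpha>. coframe lam i u d $ \<alpha>"
    have "gap_metric A lam u c $ \<mu> $ \<nu> =
        (\<Sum>i\<in>UNIV. (\<Sum>\<alpha>\<in>UNIV. ?J \<alpha> \<mu> * ?L i \<alpha>) * (\<Sum>\<beta>\<in>UNIV. ?J \<beta> \<nu> * ?L i \<beta>))"
      using that by (simp add: gap_metric_def coframe_transform[OF assms that])
    also have "\<dots> = (\<Sum>i\<in>UNIV. \<Sum>\<alpha>\<in>UNIV. \<Sum>\<beta>\<in>UNIV. ?J \<alpha> \<mu> * ?J \<beta> \<nu> * (?L i \<alpha> * ?L i \<beta>))"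
      by (simp add: sum_product mult_ac)
    \<comment> \<open>Two exchanges move the mesh sum innermost, where it forms the metric in
      \<open>d\<close>.\<close>
    also have "\<dots> = (\<Sum>\<alpha>\<in>UNIV. \<Sum>i\<in>UNIV. \<Sum>\<beta>\<in>UNIV. ?J \<alpha> \<mu> * ?J \<beta> \<nu> * (?L i \<alpha> * ?L i \<beta>))"
      by (rule sum.swap)
    also have "\<dots> = (\<Sum>\<alpha>\<in>UNIV. \<Sum>\<beta>\<in>UNIV. \<Sum>i\<in>UNIV. ?J \<alpha> \<mu> * ?J \<beta> \<nu> * (?L i \<alpha> * ?L i \<beta>))"
      by (rule sum.cong[OF refl sum.swap])
    finally show ?thesis
      using that by (simp add: gap_metric_def sum_distrib_left)
  qed
  then show ?thesis
    by (auto simp: tensor02_space_def gap_metric_def)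
qed

lemma gap_metric_smooth:
  assumes "GAP_space M A lam"
  shows "smooth_components A (gap_metric A lam)"
  unfolding smooth_components_def smooth_on_def
proof (intro ballI allI)
  fix c k
  assume c: "c \<in> A"
  have man: "smooth_manifold M A"
    using assms by (simp add: GAP_space_def)
  let ?S = "(snd c ` fst c) \<times> (UNIV :: (real^'b) set)"
  let ?u = "inv_into (tangent_over A c) (induced_chart c)"
  let ?W = "\<lambda>z. matrix_inv (frame_matrix lam (?u z) c)"
  note u = inv_induced_chart[OF man c]
  have S: "open ?S"
    using man c by (auto simp: smooth_manifold_def is_chart_def intro: open_Times)
  have lam: "Ck_on k ?S (\<lambda>z. lam i (?u z) c)" for i
    using assms c by (auto simp: GAP_space_def pi_vector_field_def smooth_components_def smooth_on_def)
  have W: "Ck_on k ?S (\<lambda>z. ?W z $ a $ i)" for a i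
  proof (rule Ck_on_matrix_inv[OF S])
    show "Ck_on k ?S (\<lambda>z. frame_matrix lam (?u z) c $ i $ j)" for i j
      using Ck_on_vec_nth[OF S lam] by (simp add: frame_matrix_def)
  qed (use frame_matrix_invertible[OF assms u] in auto)
  show "Ck_on k ?S (\<lambda>z. gap_metric A lam (?u z) c)"
  \<comment> \<open>\<open>gap_metric\<close> is restricted to \<open>charts_at\<close>, so its
    formula is available only where \<open>c\<close> is a chart around the base point of
    \<open>?u z\<close>; on \<open>?S\<close> this is \<open>u(2)\<close>.\<close>
  proof (rule Ck_on_cong[OF S])
    show "Ck_on k ?S (\<lambda>z. \<chi> \<mu> \<nu>. \<Sum>i\<in>UNIV. ?W z $ \<mu> $ i * ?W z $ \<nu> $ i)"
      by (intro Ck_on_vec_lambda Ck_on_sum Ck_on_mult S W)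
    show "(\<chi> \<mu> \<nu>. \<Sum>i\<in>UNIV. ?W z $ \<mu> $ i * ?W z $ \<nu> $ i) = gap_metric A lam (?u z) c"
      if "z \<in> ?S" for z
      using u(2)[OF that] by (simp add: gap_metric_def coframe_def)
  qed
qed

theorem theorem3p2:
  fixes M :: "'a topology"
    and A :: "('a, 'n::finite) chart set"
    and lam :: "'n \<Rightarrow> 'a \<times> ('a, 'n) tvec \<Rightarrow> ('a, 'n) tvec"
  assumes "GAP_space M A lam"
  shows "generalized_Lagrange_space M A (gap_metric A lam) \<and>
    (\<forall>u\<in>tangent_bundle M A. \<forall>c\<in>charts_at A (fst u).
       gap_metric A lam u c ** gap_metric_inverse A lam u c = mat 1 \<and>
       gap_metric_inverse A lam u c ** gap_metric A lam u c = mat 1)"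
proof -
  note inv = gap_metric_right_inverse[OF assms]
  have "smooth_manifold M A"
    using assms by (simp add: GAP_space_def)
  moreover have "symmetric_form (gap_metric A lam u c)" if "c \<in> charts_at A (fst u)" for u c
    using that by (simp add: symmetric_form_def gap_metric_def mult.commute)
  moreover have "nondegenerate_form (gap_metric A lam u c)"
    if "u \<in> tangent_bundle M A" "c \<in> charts_at A (fst u)" for u c
    using inv[OF that] by (intro nondegenerate_form_if_invertible) (metis invertible_right_inverse)
  ultimately have "generalized_Lagrange_space M A (gap_metric A lam)"
    using gap_metric_tensor[OF assms] gap_metric_smooth[OF assms]
    by (simp add: generalized_Lagrange_space_def generalized_Lagrange_metric_def pi_tensor_field02_def)
  \<comment> \<open>For square matrices a right inverse is also a left inverse.\<close>
  then show ?thesis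
    using inv matrix_left_right_inverse by blast
qed

end
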